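(* Let $n$ be a positive integer, let $\lambda$ be a partition of $n$, and let $\mathfrak{S}_n(\lambda)$ be the set of permutations in $\mathfrak{S}_n$ of cycle type $\lambda$. Then, for any integer $i\ge0$, the coefficient of $s^i$ in $$\sum_{\pi\in\mathfrak{S}_n(\lambda)}s^{\mathrm{cval}(\pi)}t^{\mathrm{exc}(\pi)}$$ is a $\gamma$-positive polynomial in $t$.
   Context: $[n]=\{1,\dots,n\}$ and $\mathfrak{S}_n$ is the symmetric group on $[n]$. For $\pi\in\mathfrak{S}_n$, an excedance of $\pi$ is an $i\in[n]$ with $i<\pi(i)$, and $\mathrm{exc}(\pi)$ is the number of excedances. A cyclic valley of $\pi$ is an $i\in[n]$ with $\pi^{-1}(i)>i<\pi(i)$, and $\mathrm{cval}(\pi)$ is the number of cyclic valleys. A polynomial $f(t)$ is $\gamma$-positive (with center of symmetry $m/2$, for some integer $m\ge0$) if it can be written as $f(t)=\sum_{j=0}^{\lfloor m/2\rfloor}\gamma_j t^j(1+t)^{m-2j}$ for some non-negative integers $\gamma_j$. (The zero polynomial is $\gamma$-positive under this definition.) *)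

theory Defs
  imports
    "HOL-Library.Multiset"
    "HOL-Combinatorics.Permutations"
    "HOL-Combinatorics.Orbits"
    "HOL-Computational_Algebra.Polynomial"
begin

definition exc :: "nat \<Rightarrow> (nat \<Rightarrow> nat) \<Rightarrow> nat" where
  "exc n \<pi> = card {i \<in> {1..n}. i < \<pi> i}"

definition cval :: "nat \<Rightarrow> (nat \<Rightarrow> nat) \<Rightarrow> nat" where
  "cval n \<pi> = card {i \<in> {1..n}. i < inv \<pi> i \<and> i < \<pi> i}"

definition partition_of :: "nat \<Rightarrow> nat multiset \<Rightarrow> bool" where
  "partition_of n \<mu> \<longleftrightarrow> 0 \<notin># \<mu> \<and> sum_mset \<mu> = n"

text \<open>The orbits of the elements of \<open>{1..n}\<close> form a set, so each cycle contributes its length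
  exactly once; a fixed point contributes a part \<open>1\<close>.\<close>

definition cycle_type :: "nat \<Rightarrow> (nat \<Rightarrow> nat) \<Rightarrow> nat multiset" where
  "cycle_type n \<pi> = image_mset card (mset_set (orbit \<pi> ` {1..n}))"

definition perms_of_type :: "nat \<Rightarrow> nat multiset \<Rightarrow> (nat \<Rightarrow> nat) set" where
  "perms_of_type n \<mu> = {\<pi>. \<pi> permutes {1..n} \<and> cycle_type n \<pi> = \<mu>}"

lemma finite_perms_of_type: "finite (perms_of_type n \<mu>)"
  by (rule finite_subset [OF _ finite_permutations [of "{1..n}"]]) (auto simp: perms_of_type_def)

text \<open>The outer variable of the bivariate polynomial is \<open>s\<close>, the inner one is \<open>t\<close>:
  \<open>monom (monom 1 b) a\<close> is \<open>s ^ a * t ^ b\<close>.\<close>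

definition cval_exc_poly :: "nat \<Rightarrow> nat multiset \<Rightarrow> int poly poly" where
  "cval_exc_poly n \<mu> = (\<Sum>\<pi>\<in>perms_of_type n \<mu>. monom (monom 1 (exc n \<pi>)) (cval n \<pi>))"

text \<open>Below, \<open>[:0, 1:]\<close> is \<open>t\<close> and \<open>[:1, 1:]\<close> is \<open>1 + t\<close>; the bound \<open>j \<le> m div 2\<close> keeps the
  subtraction in the exponent from truncating.\<close>

definition gamma_positive :: "int poly \<Rightarrow> bool" where
  "gamma_positive f \<longleftrightarrow> (\<exists>(m::nat) (\<gamma>::nat \<Rightarrow> nat).
     f = (\<Sum>j\<le>m div 2. of_nat (\<gamma> j) * [:0, 1:] ^ j * [:1, 1:] ^ (m - 2 * j)))"

end

theory Submission
  imports Defs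
begin

text \<open>Remove a point \<open>x\<close> from its cycle. In each cycle \<open>C\<close> of the remaining permutation \<open>\<sigma>\<close> there are as
  many places \<open>y < x < \<sigma> y\<close> as places \<open>y > x > \<sigma> y\<close>. Reinserting \<open>x\<close> into \<open>C\<close> at a place of the first
  kind makes it a cyclic double ascent, at a place of the second kind a cyclic double descent; the
  kinds of all other points stay the same, and the cycle type depends on \<open>C\<close> only. Let \<open>N k\<close> count
  the permutations of type \<open>\<mu>\<close> with \<open>i\<close> cyclic valleys and \<open>k\<close> cyclic double ascents. Such a
  permutation has \<open>M - k\<close> cyclic double descents, where \<open>M\<close> is \<open>n - 2 i\<close> minus the number of parts \<open>1\<close>
  of \<open>\<mu>\<close>. Summing over \<open>x\<close> gives \<open>(k + 1) N (k + 1) = (M - k) N k\<close>, so \<open>N k = (M choose k) N 0\<close>. As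
  every excedance is a cyclic valley or a cyclic double ascent, the coefficient of \<open>s ^ i\<close> is
  \<open>N 0 t ^ i (1 + t) ^ M\<close>.\<close>

text \<open>Kept as sets, unlike \<open>exc\<close> and \<open>cval\<close>: the count runs over the
  pairs of a permutation and one of its double ascents or descents.\<close>

definition dasc :: "nat \<Rightarrow> (nat \<Rightarrow> nat) \<Rightarrow> nat set" where
  "dasc n \<pi> = {i \<in> {1..n}. inv \<pi> i < i \<and> i < \<pi> i}"

definition ddes :: "nat \<Rightarrow> (nat \<Rightarrow> nat) \<Rightarrow> nat set" where
  "ddes n \<pi> = {i \<in> {1..n}. i < inv \<pi> i \<and> \<pi> i < i}"

lemma finite_dasc [simp]: "finite (dasc n \<pi>)"
  and finite_ddes [simp]: "finite (ddes n \<pi>)"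
  by (simp_all add: dasc_def ddes_def)

section \<open>Inserting a point into a cycle\<close>

lemma permutation_orbit_eqI:
  assumes "permutation f" "y \<in> orbit f x"
  shows "orbit f y = orbit f x"
  using assms orbit_swap [OF permutation_self_in_orbit [OF assms(1)] assms(2)]
  by (blast intro: orbit_trans)

text \<open>For a fixed point \<open>x\<close> of \<open>\<sigma>\<close>, the map
  \<open>\<sigma> \<circ> transpose x y\<close> sends \<open>y\<close> to \<open>x\<close> and
  \<open>x\<close> to \<open>\<sigma> y\<close>. This splices \<open>x\<close> into the cycle of
  \<open>y\<close>, directly after \<open>y\<close>.\<close>

lemma orbit_insert_inside:
  assumes \<sigma>: "permutation \<sigma>" and x: "\<sigma> x = x" "y \<noteq> x" and z: "z \<in> insert x (orbit \<sigma> y)"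
  shows "orbit (\<sigma> \<circ> transpose x y) z = insert x (orbit \<sigma> y)"
proof -
  define \<pi> where "\<pi> = \<sigma> \<circ> transpose x y"
  have \<pi>_y: "\<pi> y = x" and \<pi>_x: "\<pi> x = \<sigma> y"
    using x by (auto simp: \<pi>_def)
  have \<pi>_other: "\<pi> w = \<sigma> w" if "w \<noteq> x" "w \<noteq> y" for w
    using that by (auto simp: \<pi>_def)
  have perm: "permutation \<pi>"
    using \<sigma> by (simp add: \<pi>_def permutation_compose permutation_swap_id)
  have x_in: "x \<in> orbit \<pi> y"
    using orbit.base [of \<pi> y] by (simp add: \<pi>_y)
  have "w \<in> orbit \<pi> y" if "w \<in> orbit \<sigma> y" for w
    using that
  proof induction
    case base
    show ?case using orbit.step [OF x_in] by (simp add: \<pi>_x)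
  next
    case (step w)
    then show ?case
      by (metis \<pi>_other \<pi>_x orbit.step x(1) x_in)
  qed
  then have sub: "insert x (orbit \<sigma> y) \<subseteq> orbit \<pi> y"
    using x_in by blast
  have "w \<in> insert x (orbit \<sigma> y)" if "w \<in> orbit \<pi> y" for w
    using that
  proof induction
    case (step w)
    then show ?case
      by (metis \<pi>_other \<pi>_x \<pi>_y insert_iff orbit.base orbit.step)
  qed (simp add: \<pi>_y)
  with sub have eq: "orbit \<pi> y = insert x (orbit \<sigma> y)" by blast
  have "orbit \<pi> z = orbit \<pi> y"
    using z perm unfolding eq [symmetric] by (intro permutation_orbit_eqI)
  with eq show ?thesis by (simp add: \<pi>_def)
qed

text \<open>The two permutations differ only at \<open>x\<close> and \<open>y\<close>, and the cycle
  of \<open>z\<close> meets neither.\<close>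

lemma orbit_insert_outside:
  assumes \<sigma>: "permutation \<sigma>" and x: "\<sigma> x = x" and z: "z \<notin> insert x (orbit \<sigma> y)"
  shows "orbit (\<sigma> \<circ> transpose x y) z = orbit \<sigma> z"
proof -
  have self: "w \<in> orbit \<sigma> w" for w
    using \<sigma> by (rule permutation_self_in_orbit)
  \<comment> \<open>Otherwise \<open>z\<close> would lie in the orbit of the fixed point
    \<open>x\<close>, which is a singleton.\<close>
  have "x \<notin> orbit \<sigma> z"
    using orbit_swap [OF self] z x orbit_eq_singleton_iff [of \<sigma> x] by blast
  moreover have "y \<notin> orbit \<sigma> z"
    using orbit_swap [OF self] z by blast
  ultimately have agree: "(\<sigma> \<circ> transpose x y) w = \<sigma> w" if "w \<in> orbit \<sigma> z" for w
    using that by (metis comp_apply transpose_apply_other)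
  show ?thesis
  proof (intro equalityI subsetI)
    fix w assume "w \<in> orbit (\<sigma> \<circ> transpose x y) z"
    then show "w \<in> orbit \<sigma> z"
      by induction (use agree self in \<open>auto simp del: comp_apply intro: orbit.intros\<close>)
  next
    fix w assume "w \<in> orbit \<sigma> z"
    then show "w \<in> orbit (\<sigma> \<circ> transpose x y) z"
    proof induction
      case base
      show ?case using orbit.base [of "\<sigma> \<circ> transpose x y" z] by (simp only: agree [OF self])
    next
      case (step w)
      show ?case using orbit.step [OF step.IH] by (simp only: agree [OF step.hyps])
    qed
  qed
qed

text \<open>The two insertions yield different permutations in general, but the same orbits: the
  description of these involves \<open>y\<close> only through
  \<open>orbit \<sigma> y\<close>.\<close>

lemma cycle_type_insert_cong:
  assumes "permutation \<sigma>" "\<sigma> x = x" "y \<noteq> x" "y' \<noteq> x" "orbit \<sigma> y = orbit \<sigma> y'"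
  shows "cycle_type n (\<sigma> \<circ> transpose x y) = cycle_type n (\<sigma> \<circ> transpose x y')"
proof -
  have "orbit (\<sigma> \<circ> transpose x y) z = orbit (\<sigma> \<circ> transpose x y') z" for z
    using orbit_insert_inside [of \<sigma> x y z] orbit_insert_inside [of \<sigma> x y' z]
      orbit_insert_outside [of \<sigma> x z y] orbit_insert_outside [of \<sigma> x z y'] assms
    by (cases "z \<in> insert x (orbit \<sigma> y)") auto
  then show ?thesis by (simp add: cycle_type_def)
qed

section \<open>Crossings of a value along the cycles\<close>

text \<open>As \<open>\<sigma>\<close> permutes \<open>C\<close>, equally many \<open>y\<close>
  satisfy \<open>\<sigma> y < x\<close> and \<open>y < x\<close>. Discarding those that satisfy both
  leaves the down-crossings and the up-crossings.\<close>

lemma card_crossings_eq: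
  fixes x :: "'a :: linorder"
  assumes "finite C" "bij_betw \<sigma> C C" "x \<notin> C"
  shows "card {y \<in> C. y < x \<and> x < \<sigma> y} = card {y \<in> C. x < y \<and> \<sigma> y < x}"
proof -
  have ne: "y \<noteq> x \<and> \<sigma> y \<noteq> x" if "y \<in> C" for y
    using that assms bij_betwE by fastforce
  have img: "\<sigma> ` {y \<in> C. \<sigma> y < x} = {y \<in> C. y < x}"
    using assms(2) by (auto simp: bij_betw_def)
  have "card {y \<in> C. \<sigma> y < x} = card {y \<in> C. y < x}"
    using assms(2) unfolding img [symmetric]
    by (subst card_image) (auto simp: bij_betw_def intro: inj_on_subset)
  moreover have "{y \<in> C. \<sigma> y < x} = {y \<in> C. x < y \<and> \<sigma> y < x} \<union> {y \<in> C. y < x \<and> \<sigma> y < x}"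
    using ne by force
  moreover have "{y \<in> C. y < x} = {y \<in> C. y < x \<and> x < \<sigma> y} \<union> {y \<in> C. y < x \<and> \<sigma> y < x}"
    using ne by force
  moreover have "card ({y \<in> C. x < y \<and> \<sigma> y < x} \<union> {y \<in> C. y < x \<and> \<sigma> y < x})
      = card {y \<in> C. x < y \<and> \<sigma> y < x} + card {y \<in> C. y < x \<and> \<sigma> y < x}"
    by (rule card_Un_disjoint) (use assms(1) in auto)
  moreover have "card ({y \<in> C. y < x \<and> x < \<sigma> y} \<union> {y \<in> C. y < x \<and> \<sigma> y < x})
      = card {y \<in> C. y < x \<and> x < \<sigma> y} + card {y \<in> C. y < x \<and> \<sigma> y < x}"
    by (rule card_Un_disjoint) (use assms(1) in auto)
  ultimately show ?thesis by simp
qed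

text \<open>The type is imposed on the result of the insertion, since it depends on the cycle that
  receives \<open>x\<close>.\<close>

definition up_positions where
  "up_positions n \<mu> \<sigma> x =
    {y \<in> {1..n}. y < x \<and> x < \<sigma> y \<and> cycle_type n (\<sigma> \<circ> transpose x y) = \<mu>}"

definition down_positions where
  "down_positions n \<mu> \<sigma> x =
    {y \<in> {1..n}. x < y \<and> \<sigma> y < x \<and> cycle_type n (\<sigma> \<circ> transpose x y) = \<mu>}"

text \<open>Compared cycle by cycle: either every place in a cycle produces type
  \<open>\<mu>\<close> or none does, so each fibre is empty or consists of all crossings of that
  cycle.\<close>

lemma card_up_positions_eq:
  assumes \<sigma>: "\<sigma> permutes {1..n}" and x: "\<sigma> x = x"
  shows "card (up_positions n \<mu> \<sigma> x) = card (down_positions n \<mu> \<sigma> x)"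
proof -
  have perm: "permutation \<sigma>"
    using \<sigma> by (auto simp: permutation_permutes)
  have self: "w \<in> orbit \<sigma> w" for w
    using perm by (rule permutation_self_in_orbit)
  have fibre: "card {y \<in> up_positions n \<mu> \<sigma> x. orbit \<sigma> y = C}
      = card {y \<in> down_positions n \<mu> \<sigma> x. orbit \<sigma> y = C}" if C: "C \<in> orbit \<sigma> ` {1..n}" for C
  \<comment> \<open>The condition \<open>y \<noteq> x\<close> puts the trivial cycle of
    \<open>x\<close> into the empty case.\<close>
  proof (cases "\<exists>y. y \<noteq> x \<and> orbit \<sigma> y = C \<and> cycle_type n (\<sigma> \<circ> transpose x y) = \<mu>")
    case False
    then have none: "{y \<in> up_positions n \<mu> \<sigma> x. orbit \<sigma> y = C} = {}"
      "{y \<in> down_positions n \<mu> \<sigma> x. orbit \<sigma> y = C} = {}"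
      by (auto simp: up_positions_def down_positions_def)
    show ?thesis unfolding none by simp
  next
    case True
    then obtain y0 where y0: "y0 \<noteq> x" "orbit \<sigma> y0 = C" "cycle_type n (\<sigma> \<circ> transpose x y0) = \<mu>"
      by blast
    have in_C: "y \<in> C \<longleftrightarrow> orbit \<sigma> y = C" for y
      using self [of y] permutation_orbit_eqI [OF perm, of y y0] y0(2) by auto
    have C_sub: "C \<subseteq> {1..n}"
      using C permutes_orbit_subset [OF \<sigma>] by blast
    have type: "cycle_type n (\<sigma> \<circ> transpose x y) = \<mu>" if "y \<in> C" "y \<noteq> x" for y
      using cycle_type_insert_cong [OF perm x that(2) y0(1)] that y0 in_C by auto
    have "x \<notin> C"
      using in_C [of x] x y0(1,2) self [of y0] orbit_eq_singleton_iff [of \<sigma> x] by auto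
    moreover have "\<sigma> ` C \<subseteq> C"
      using y0(2) by (auto intro: orbit.step)
    then have "bij_betw \<sigma> C C"
      using permutes_inj_on [OF \<sigma>] endo_inj_surj [of C \<sigma>] finite_subset [OF C_sub]
      by (simp add: bij_betw_def)
    ultimately have "card {y \<in> C. y < x \<and> x < \<sigma> y} = card {y \<in> C. x < y \<and> \<sigma> y < x}"
      using C_sub finite_subset by (intro card_crossings_eq) auto
    moreover have "{y \<in> up_positions n \<mu> \<sigma> x. orbit \<sigma> y = C} = {y \<in> C. y < x \<and> x < \<sigma> y}"
      "{y \<in> down_positions n \<mu> \<sigma> x. orbit \<sigma> y = C} = {y \<in> C. x < y \<and> \<sigma> y < x}"
      using type C_sub by (auto simp: up_positions_def down_positions_def in_C [symmetric])
    ultimately show ?thesis by simp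
  qed
  have "card A = (\<Sum>C\<in>orbit \<sigma> ` {1..n}. card {y \<in> A. orbit \<sigma> y = C})" if "A \<subseteq> {1..n}" for A
    using sum.group [of A "orbit \<sigma> ` {1..n}" "orbit \<sigma>" "\<lambda>_. 1 :: nat"] finite_subset [OF that]
      image_mono [OF that, of "orbit \<sigma>"]
    by simp
  moreover have "up_positions n \<mu> \<sigma> x \<subseteq> {1..n}" "down_positions n \<mu> \<sigma> x \<subseteq> {1..n}"
    by (auto simp: up_positions_def down_positions_def)
  ultimately show ?thesis
    using fibre by simp
qed

section \<open>Effect of insertion and removal on the kinds of points\<close>

lemma insert_permutes:
  assumes "\<sigma> permutes {1..n}" "x \<in> {1..n}" "y \<in> {1..n}"
  shows "\<sigma> \<circ> transpose x y permutes {1..n}"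
  using assms by (intro permutes_compose permutes_swap_id)

lemma insert_values:
  assumes \<sigma>: "\<sigma> permutes {1..n}" and x: "\<sigma> x = x" and y: "y \<noteq> x" "\<sigma> y \<noteq> y"
  defines "\<pi> \<equiv> \<sigma> \<circ> transpose x y"
  shows "\<pi> x = \<sigma> y" "\<pi> y = x" "inv \<pi> x = y" "inv \<pi> (\<sigma> y) = x"
    "w \<noteq> x \<Longrightarrow> w \<noteq> y \<Longrightarrow> \<pi> w = \<sigma> w" "w \<noteq> x \<Longrightarrow> w \<noteq> \<sigma> y \<Longrightarrow> inv \<pi> w = inv \<sigma> w"
proof -
  have bij: "bij \<sigma>" using \<sigma> by (rule permutes_bij)
  have inv: "inv \<pi> = transpose x y \<circ> inv \<sigma>"
    unfolding \<pi>_def by (subst o_inv_distrib) (use bij in auto)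
  have invx: "inv \<sigma> x = x" and invy: "inv \<sigma> (\<sigma> y) = y"
    using x permutes_inv_eq [OF \<sigma>] by auto
  show "\<pi> x = \<sigma> y" "\<pi> y = x" "inv \<pi> x = y" "inv \<pi> (\<sigma> y) = x"
    using x invx invy by (simp_all add: \<pi>_def inv [unfolded \<pi>_def])
  show "w \<noteq> x \<Longrightarrow> w \<noteq> y \<Longrightarrow> \<pi> w = \<sigma> w" by (simp add: \<pi>_def)
  show "inv \<pi> w = inv \<sigma> w" if "w \<noteq> x" "w \<noteq> \<sigma> y"
  proof -
    have "inv \<sigma> w \<noteq> x" "inv \<sigma> w \<noteq> y"
      using that x permutes_inv_eq [OF \<sigma>] by auto
    then show ?thesis by (simp add: inv)
  qed
qed

text \<open>Only the image of \<open>y\<close> and the preimage of \<open>\<sigma> y\<close> change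
  for the old points, both to \<open>x\<close>. As \<open>x\<close> lies between \<open>y\<close>
  and \<open>\<sigma> y\<close>, all comparisons there keep their direction.\<close>

lemma insert_up:
  assumes \<sigma>: "\<sigma> permutes {1..n}" and x: "\<sigma> x = x" "x \<in> {1..n}" and y: "y < x" "x < \<sigma> y"
  defines "\<pi> \<equiv> \<sigma> \<circ> transpose x y"
  shows "dasc n \<pi> = insert x (dasc n \<sigma>)" "cval n \<pi> = cval n \<sigma>"
proof -
  have ne: "y \<noteq> x" "\<sigma> y \<noteq> y" using y by auto
  note vals = insert_values [OF \<sigma> x(1) ne, folded \<pi>_def]
  have invx: "inv \<sigma> x = x" and invy: "inv \<sigma> (\<sigma> y) = y"
    using x permutes_inv_eq [OF \<sigma>] by auto
  have desc: "w < \<pi> w \<longleftrightarrow> w < \<sigma> w" "inv \<pi> w < w \<longleftrightarrow> inv \<sigma> w < w" "w < inv \<pi> w \<longleftrightarrow> w < inv \<sigma> w"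
    if "w \<noteq> x" for w
    using vals(1-4) vals(5,6) [of w] y that invy
    by (cases "w = y"; cases "w = \<sigma> y"; simp)+
  have "w \<in> dasc n \<pi> \<longleftrightarrow> w \<in> insert x (dasc n \<sigma>)" for w
    using desc [of w] x vals(1-4) y invx by (cases "w = x") (auto simp: dasc_def)
  then show "dasc n \<pi> = insert x (dasc n \<sigma>)" by blast
  have "w < inv \<pi> w \<and> w < \<pi> w \<longleftrightarrow> w < inv \<sigma> w \<and> w < \<sigma> w" for w
    using desc [of w] x vals(1-4) y invx by (cases "w = x") auto
  then show "cval n \<pi> = cval n \<sigma>" by (simp add: cval_def)
qed

text \<open>Mirror image of \<open>insert_up\<close>: the new point is a cyclic double descent,
  which neither statistic sees.\<close>

lemma insert_down:
  assumes \<sigma>: "\<sigma> permutes {1..n}" and x: "\<sigma> x = x" and y: "x < y" "\<sigma> y < x"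
  defines "\<pi> \<equiv> \<sigma> \<circ> transpose x y"
  shows "dasc n \<pi> = dasc n \<sigma>" "cval n \<pi> = cval n \<sigma>"
proof -
  have ne: "y \<noteq> x" "\<sigma> y \<noteq> y" using y by auto
  note vals = insert_values [OF \<sigma> x(1) ne, folded \<pi>_def]
  have invx: "inv \<sigma> x = x" and invy: "inv \<sigma> (\<sigma> y) = y"
    using x permutes_inv_eq [OF \<sigma>] by auto
  have desc: "w < \<pi> w \<longleftrightarrow> w < \<sigma> w" "inv \<pi> w < w \<longleftrightarrow> inv \<sigma> w < w" "w < inv \<pi> w \<longleftrightarrow> w < inv \<sigma> w"
    if "w \<noteq> x" for w
    using vals(1-4) vals(5,6) [of w] y that invy
    by (cases "w = y"; cases "w = \<sigma> y"; simp)+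
  have "inv \<pi> w < w \<and> w < \<pi> w \<longleftrightarrow> inv \<sigma> w < w \<and> w < \<sigma> w"
    "w < inv \<pi> w \<and> w < \<pi> w \<longleftrightarrow> w < inv \<sigma> w \<and> w < \<sigma> w" for w
    using desc [of w] x vals(1-4) y invx by (cases "w = x"; auto)+
  then show "dasc n \<pi> = dasc n \<sigma>" "cval n \<pi> = cval n \<sigma>" by (simp_all add: cval_def dasc_def)
qed

text \<open>The transposition is an involution, so the same composition removes \<open>x\<close> and
  puts it back after its predecessor. For a fixed point, \<open>y = x\<close> and nothing
  changes.\<close>

lemma remove_point:
  assumes \<pi>: "\<pi> permutes {1..n}" and x: "x \<in> {1..n}"
  defines "y \<equiv> inv \<pi> x"
  defines "\<sigma> \<equiv> \<pi> \<circ> transpose x y"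
  shows "\<sigma> permutes {1..n}" "\<sigma> x = x" "\<sigma> y = \<pi> x" "\<sigma> \<circ> transpose x y = \<pi>" "y \<in> {1..n}"
proof -
  have \<pi>_y: "\<pi> y = x"
    unfolding y_def by (rule permutes_inverses [OF \<pi>])
  show y: "y \<in> {1..n}"
    using permutes_in_image [OF permutes_inv [OF \<pi>]] x by (simp add: y_def)
  show "\<sigma> permutes {1..n}"
    unfolding \<sigma>_def using \<pi> x y by (intro permutes_compose permutes_swap_id)
  show "\<sigma> x = x" "\<sigma> y = \<pi> x" "\<sigma> \<circ> transpose x y = \<pi>"
    by (simp_all add: \<sigma>_def \<pi>_y o_assoc [symmetric])
qed

section \<open>Bijections between insertions and marked permutations\<close>

text \<open>Its cardinality is the number \<open>N k\<close> of the overview.\<close>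

definition level :: "nat \<Rightarrow> nat multiset \<Rightarrow> nat \<Rightarrow> nat \<Rightarrow> (nat \<Rightarrow> nat) set" where
  "level n \<mu> i k = {\<pi> \<in> perms_of_type n \<mu>. cval n \<pi> = i \<and> card (dasc n \<pi>) = k}"

lemma finite_level [simp]: "finite (level n \<mu> i k)"
  by (simp add: level_def finite_perms_of_type)

text \<open>No cycle type is prescribed; it enters through the positions. The double ascents are
  counted before \<open>x\<close> is inserted.\<close>

definition bases :: "nat \<Rightarrow> nat \<Rightarrow> nat \<Rightarrow> nat \<Rightarrow> (nat \<Rightarrow> nat) set" where
  "bases n i k x = {\<sigma>. \<sigma> permutes {1..n} \<and> \<sigma> x = x \<and> cval n \<sigma> = i \<and> card (dasc n \<sigma>) = k}"

lemma finite_bases [simp]: "finite (bases n i k x)"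
  by (rule finite_subset [OF _ finite_permutations [of "{1..n}"]]) (auto simp: bases_def)

text \<open>The inverse removes \<open>x\<close> and records its predecessor. The index rises from
  \<open>k\<close> to \<open>Suc k\<close> because \<open>x\<close> itself becomes a double
  ascent.\<close>

lemma level_dasc_bij:
  assumes x: "x \<in> {1..n}"
  shows "bij_betw (\<lambda>(\<sigma>, y). \<sigma> \<circ> transpose x y)
    (Sigma (bases n i k x) (\<lambda>\<sigma>. up_positions n \<mu> \<sigma> x)) {\<pi> \<in> level n \<mu> i (Suc k). x \<in> dasc n \<pi>}"
proof (rule bij_betw_byWitness [where f' = "\<lambda>\<pi>. (\<pi> \<circ> transpose x (inv \<pi> x), inv \<pi> x)"])
  have fresh: "x \<notin> dasc n \<sigma>" if "\<sigma> x = x" for \<sigma>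
    using that by (simp add: dasc_def)
  show "\<forall>a\<in>Sigma (bases n i k x) (\<lambda>\<sigma>. up_positions n \<mu> \<sigma> x).
      (\<lambda>\<pi>. (\<pi> \<circ> transpose x (inv \<pi> x), inv \<pi> x)) ((\<lambda>(\<sigma>, y). \<sigma> \<circ> transpose x y) a) = a"
    by (auto simp: bases_def up_positions_def insert_values(3) o_assoc [symmetric])
  show "\<forall>\<pi>\<in>{\<pi> \<in> level n \<mu> i (Suc k). x \<in> dasc n \<pi>}.
      (\<lambda>(\<sigma>, y). \<sigma> \<circ> transpose x y) (\<pi> \<circ> transpose x (inv \<pi> x), inv \<pi> x) = \<pi>"
    by (simp add: o_assoc [symmetric])
  show "(\<lambda>(\<sigma>, y). \<sigma> \<circ> transpose x y) ` (Sigma (bases n i k x) (\<lambda>\<sigma>. up_positions n \<mu> \<sigma> x))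
      \<subseteq> {\<pi> \<in> level n \<mu> i (Suc k). x \<in> dasc n \<pi>}"
  proof clarify
    fix \<sigma> y assume *: "\<sigma> \<in> bases n i k x" "y \<in> up_positions n \<mu> \<sigma> x"
    then have \<sigma>: "\<sigma> permutes {1..n}" "\<sigma> x = x" and y: "y \<in> {1..n}" "y < x" "x < \<sigma> y"
      by (auto simp: bases_def up_positions_def)
    from * insert_up [OF \<sigma> x y(2,3)] insert_permutes [OF \<sigma>(1) x y(1)] fresh [of \<sigma>, OF \<sigma>(2)]
    show "\<sigma> \<circ> transpose x y \<in> level n \<mu> i (Suc k) \<and> x \<in> dasc n (\<sigma> \<circ> transpose x y)"
      by (simp add: bases_def up_positions_def level_def perms_of_type_def)
  qed
  show "(\<lambda>\<pi>. (\<pi> \<circ> transpose x (inv \<pi> x), inv \<pi> x)) ` {\<pi> \<in> level n \<mu> i (Suc k). x \<in> dasc n \<pi>}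
      \<subseteq> Sigma (bases n i k x) (\<lambda>\<sigma>. up_positions n \<mu> \<sigma> x)"
  proof (rule image_subsetI)
    fix \<pi> assume "\<pi> \<in> {\<pi> \<in> level n \<mu> i (Suc k). x \<in> dasc n \<pi>}"
    then have \<pi>: "\<pi> \<in> level n \<mu> i (Suc k)" "x \<in> dasc n \<pi>" by simp_all
    define y \<sigma> where "y = inv \<pi> x" and "\<sigma> = \<pi> \<circ> transpose x y"
    have perm: "\<pi> permutes {1..n}" using \<pi> by (simp add: level_def perms_of_type_def)
    note rem = remove_point [OF perm x, folded y_def, folded \<sigma>_def]
    have cross: "y < x" "x < \<sigma> y"
      using \<pi>(2) rem by (auto simp: dasc_def y_def)
    note up = insert_up [OF rem(1,2) x cross, unfolded rem(4)]
    have "\<sigma> \<in> bases n i k x" "y \<in> up_positions n \<mu> \<sigma> x"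
      using \<pi> up rem fresh [of \<sigma>] cross
      by (auto simp: bases_def up_positions_def level_def perms_of_type_def simp del: comp_apply)
    then show "(\<pi> \<circ> transpose x (inv \<pi> x), inv \<pi> x)
        \<in> Sigma (bases n i k x) (\<lambda>\<sigma>. up_positions n \<mu> \<sigma> x)"
      by (simp add: y_def \<sigma>_def)
  qed
qed

text \<open>The bases are those of \<open>level_dasc_bij\<close>, but the level stays at
  \<open>k\<close>, as an inserted double descent leaves \<open>dasc\<close> alone.\<close>

lemma level_ddes_bij:
  assumes x: "x \<in> {1..n}"
  shows "bij_betw (\<lambda>(\<sigma>, y). \<sigma> \<circ> transpose x y)
    (Sigma (bases n i k x) (\<lambda>\<sigma>. down_positions n \<mu> \<sigma> x)) {\<pi> \<in> level n \<mu> i k. x \<in> ddes n \<pi>}"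
proof (rule bij_betw_byWitness [where f' = "\<lambda>\<pi>. (\<pi> \<circ> transpose x (inv \<pi> x), inv \<pi> x)"])
  show "\<forall>a\<in>Sigma (bases n i k x) (\<lambda>\<sigma>. down_positions n \<mu> \<sigma> x).
      (\<lambda>\<pi>. (\<pi> \<circ> transpose x (inv \<pi> x), inv \<pi> x)) ((\<lambda>(\<sigma>, y). \<sigma> \<circ> transpose x y) a) = a"
    by (auto simp: bases_def down_positions_def insert_values(3) o_assoc [symmetric])
  show "\<forall>\<pi>\<in>{\<pi> \<in> level n \<mu> i k. x \<in> ddes n \<pi>}.
      (\<lambda>(\<sigma>, y). \<sigma> \<circ> transpose x y) (\<pi> \<circ> transpose x (inv \<pi> x), inv \<pi> x) = \<pi>"
    by (simp add: o_assoc [symmetric])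
  show "(\<lambda>(\<sigma>, y). \<sigma> \<circ> transpose x y) ` (Sigma (bases n i k x) (\<lambda>\<sigma>. down_positions n \<mu> \<sigma> x))
      \<subseteq> {\<pi> \<in> level n \<mu> i k. x \<in> ddes n \<pi>}"
  proof clarify
    fix \<sigma> y assume *: "\<sigma> \<in> bases n i k x" "y \<in> down_positions n \<mu> \<sigma> x"
    then have \<sigma>: "\<sigma> permutes {1..n}" "\<sigma> x = x" and y: "y \<in> {1..n}" "x < y" "\<sigma> y < x"
      by (auto simp: bases_def down_positions_def)
    have ne: "y \<noteq> x" "\<sigma> y \<noteq> y" using y by auto
    have "x \<in> ddes n (\<sigma> \<circ> transpose x y)"
      unfolding ddes_def using insert_values(1,3) [OF \<sigma> ne] x y by simp
    with * insert_down [OF \<sigma> y(2,3)] insert_permutes [OF \<sigma>(1) x y(1)]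
    show "\<sigma> \<circ> transpose x y \<in> level n \<mu> i k \<and> x \<in> ddes n (\<sigma> \<circ> transpose x y)"
      by (simp add: bases_def down_positions_def level_def perms_of_type_def)
  qed
  show "(\<lambda>\<pi>. (\<pi> \<circ> transpose x (inv \<pi> x), inv \<pi> x)) ` {\<pi> \<in> level n \<mu> i k. x \<in> ddes n \<pi>}
      \<subseteq> Sigma (bases n i k x) (\<lambda>\<sigma>. down_positions n \<mu> \<sigma> x)"
  proof (rule image_subsetI)
    fix \<pi> assume "\<pi> \<in> {\<pi> \<in> level n \<mu> i k. x \<in> ddes n \<pi>}"
    then have \<pi>: "\<pi> \<in> level n \<mu> i k" "x \<in> ddes n \<pi>" by simp_all
    define y \<sigma> where "y = inv \<pi> x" and "\<sigma> = \<pi> \<circ> transpose x y"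
    have perm: "\<pi> permutes {1..n}" using \<pi> by (simp add: level_def perms_of_type_def)
    note rem = remove_point [OF perm x, folded y_def, folded \<sigma>_def]
    have cross: "x < y" "\<sigma> y < x"
      using \<pi>(2) rem by (auto simp: ddes_def y_def)
    note down = insert_down [OF rem(1,2) cross, unfolded rem(4)]
    have "\<sigma> \<in> bases n i k x" "y \<in> down_positions n \<mu> \<sigma> x"
      using \<pi> down rem cross
      by (auto simp: bases_def down_positions_def level_def perms_of_type_def simp del: comp_apply)
    then show "(\<pi> \<circ> transpose x (inv \<pi> x), inv \<pi> x)
        \<in> Sigma (bases n i k x) (\<lambda>\<sigma>. down_positions n \<mu> \<sigma> x)"
      by (simp add: y_def \<sigma>_def)
  qed
qed

text \<open>Both sets fibre over the same bases, with fibres of equal size by the crossing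
  argument.\<close>

lemma card_level_dasc_eq_ddes:
  assumes x: "x \<in> {1..n}"
  shows "card {\<pi> \<in> level n \<mu> i (Suc k). x \<in> dasc n \<pi>} = card {\<pi> \<in> level n \<mu> i k. x \<in> ddes n \<pi>}"
proof -
  have fin: "finite (up_positions n \<mu> \<sigma> x)" "finite (down_positions n \<mu> \<sigma> x)" for \<sigma>
    by (simp_all add: up_positions_def down_positions_def)
  have "card {\<pi> \<in> level n \<mu> i (Suc k). x \<in> dasc n \<pi>}
      = (\<Sum>\<sigma>\<in>bases n i k x. card (up_positions n \<mu> \<sigma> x))"
    using bij_betw_same_card [OF level_dasc_bij [OF x, of i k \<mu>]] fin by simp
  also have "\<dots> = (\<Sum>\<sigma>\<in>bases n i k x. card (down_positions n \<mu> \<sigma> x))"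
    by (intro sum.cong card_up_positions_eq) (auto simp: bases_def)
  also have "\<dots> = card {\<pi> \<in> level n \<mu> i k. x \<in> ddes n \<pi>}"
    using bij_betw_same_card [OF level_ddes_bij [OF x, of i k \<mu>]] fin by simp
  finally show ?thesis .
qed

section \<open>Counting cyclic double ascents\<close>

lemma exc_eq:
  assumes \<pi>: "\<pi> permutes {1..n}"
  shows "exc n \<pi> = cval n \<pi> + card (dasc n \<pi>)"
proof -
  have "inv \<pi> i \<noteq> i" if "i < \<pi> i" for i
    using that permutes_inv_eq [OF \<pi>] by fastforce
  then have "{i \<in> {1..n}. i < \<pi> i} = {i \<in> {1..n}. i < inv \<pi> i \<and> i < \<pi> i} \<union> dasc n \<pi>"
    by (force simp: dasc_def)
  then show ?thesis
    unfolding exc_def cval_def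
    by (simp, subst card_Un_disjoint) (auto simp: dasc_def)
qed

text \<open>A permutation maps its excedances onto the points \<open>i\<close> with \<open>inv \<pi> i < i\<close>, so cyclic peaks and
  cyclic valleys are equinumerous.\<close>

lemma card_ddes:
  assumes \<pi>: "\<pi> permutes {1..n}"
  shows "2 * cval n \<pi> + card (dasc n \<pi>) + card (ddes n \<pi>) + card {i \<in> {1..n}. \<pi> i = i} = n"
proof -
  define V P F where "V = {i \<in> {1..n}. i < inv \<pi> i \<and> i < \<pi> i}"
    and "P = {i \<in> {1..n}. inv \<pi> i < i \<and> \<pi> i < i}" and "F = {i \<in> {1..n}. \<pi> i = i}"
  have fix_iff: "inv \<pi> i = i \<longleftrightarrow> \<pi> i = i" for i
    using permutes_inv_eq [OF \<pi>] by auto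
  have img: "\<pi> ` {i \<in> {1..n}. i < \<pi> i} = {i \<in> {1..n}. inv \<pi> i < i}"
  proof (intro equalityI subsetI)
    fix i assume "i \<in> {i \<in> {1..n}. inv \<pi> i < i}"
    then show "i \<in> \<pi> ` {i \<in> {1..n}. i < \<pi> i}"
      using permutes_inverses [OF \<pi>] permutes_in_image [OF permutes_inv [OF \<pi>], of i]
      by (intro image_eqI [of _ _ "inv \<pi> i"]) auto
  qed (use permutes_inverses [OF \<pi>] permutes_in_image [OF \<pi>] in auto)
  have "exc n \<pi> = card {i \<in> {1..n}. inv \<pi> i < i}"
    unfolding exc_def img [symmetric]
    using permutes_inj_on [OF \<pi>] by (simp add: card_image)
  also have "{i \<in> {1..n}. inv \<pi> i < i} = P \<union> dasc n \<pi>"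
  proof (intro set_eqI)
    fix i
    show "i \<in> {i \<in> {1..n}. inv \<pi> i < i} \<longleftrightarrow> i \<in> P \<union> dasc n \<pi>"
      using fix_iff [of i]
      by (cases "\<pi> i" i rule: linorder_cases) (auto simp: dasc_def P_def)
  qed
  also have "card \<dots> = card P + card (dasc n \<pi>)"
    by (rule card_Un_disjoint) (auto simp: dasc_def P_def)
  finally have P: "card P = cval n \<pi>"
    using exc_eq [OF \<pi>] by simp
  \<comment> \<open>Valleys, peaks, double ascents, double descents and fixed points exhaust the
    cases; \<open>fix_iff\<close> rules out equality on one side only.\<close>
  have "{1..n} = V \<union> P \<union> dasc n \<pi> \<union> ddes n \<pi> \<union> F" (is "_ = ?U")
  proof (intro equalityI subsetI)
    fix i assume "i \<in> {1..n}"
    then show "i \<in> ?U"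
      using fix_iff [of i]
      by (cases "inv \<pi> i" i rule: linorder_cases; cases "\<pi> i" i rule: linorder_cases)
        (auto simp: V_def P_def F_def dasc_def ddes_def)
  qed (auto simp: V_def P_def F_def dasc_def ddes_def)
  then have "card {1..n} = card ?U" by (rule arg_cong)
  then have "n = card ?U" by simp
  also have "\<dots> = card V + card P + card (dasc n \<pi>) + card (ddes n \<pi>) + card F"
  proof -
    have fin: "finite V" "finite P" "finite F"
      by (simp_all add: V_def P_def F_def)
    have "V \<inter> P = {}" "(V \<union> P) \<inter> dasc n \<pi> = {}" "(V \<union> P \<union> dasc n \<pi>) \<inter> ddes n \<pi> = {}"
      "(V \<union> P \<union> dasc n \<pi> \<union> ddes n \<pi>) \<inter> F = {}"
      by (auto simp: V_def P_def F_def dasc_def ddes_def)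
    then show ?thesis
      by (simp only: card_Un_disjoint fin finite_UnI finite_dasc finite_ddes)
  qed
  finally show ?thesis
    using P by (simp add: V_def F_def cval_def)
qed

text \<open>Fixed points are the singleton orbits. Hence their number is the same for all
  permutations of one type.\<close>

lemma card_fixed_points:
  assumes \<pi>: "\<pi> permutes {1..n}"
  shows "card {i \<in> {1..n}. \<pi> i = i} = count (cycle_type n \<pi>) 1"
proof -
  have perm: "permutation \<pi>"
    using \<pi> by (auto simp: permutation_permutes)
  have "count (image_mset card (mset_set A)) 1 = card {C \<in> A. card C = 1}" if "finite A"
    for A :: "nat set set"
    using that by (simp add: count_image_mset' eq_commute [of "Suc 0"])
  then have "count (cycle_type n \<pi>) 1 = card {C \<in> orbit \<pi> ` {1..n}. card C = 1}"
    by (simp add: cycle_type_def)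
  also have "{C \<in> orbit \<pi> ` {1..n}. card C = 1} = (\<lambda>i. {i}) ` {i \<in> {1..n}. \<pi> i = i}"
  proof (intro equalityI subsetI)
    fix C assume "C \<in> {C \<in> orbit \<pi> ` {1..n}. card C = 1}"
    then obtain i where i: "i \<in> {1..n}" "C = orbit \<pi> i" "card C = 1" by blast
    then have "C = {i}"
      using permutation_self_in_orbit [OF perm, of i] by (metis card_1_singletonE singletonD)
    then show "C \<in> (\<lambda>i. {i}) ` {i \<in> {1..n}. \<pi> i = i}"
      using i orbit_eq_singleton_iff [of \<pi> i] by auto
  next
    fix C assume "C \<in> (\<lambda>i. {i}) ` {i \<in> {1..n}. \<pi> i = i}"
    then obtain i where i: "i \<in> {1..n}" "C = {i}" "\<pi> i = i" by blast
    then have "C = orbit \<pi> i"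
      using orbit_eq_singleton_iff [of \<pi> i] by simp
    then have "C \<in> orbit \<pi> ` {1..n}"
      using i(1) by (rule image_eqI)
    then show "C \<in> {C \<in> orbit \<pi> ` {1..n}. card C = 1}"
      using i(2) by simp
  qed
  also have "card \<dots> = card {i \<in> {1..n}. \<pi> i = i}"
    by (rule card_image) auto
  finally show ?thesis by simp
qed

section \<open>The recurrence between levels and its solution\<close>

text \<open>This makes the number of double descents constant on a level.\<close>

lemma level_card_sum:
  assumes "\<pi> \<in> level n \<mu> i k"
  shows "2 * i + k + card (ddes n \<pi>) = n - count \<mu> 1"
  using card_ddes [of \<pi> n] card_fixed_points [of \<pi> n] assms
  by (auto simp: level_def perms_of_type_def)

text \<open>Double counting of the pairs \<open>(a, b)\<close> with
  \<open>b \<in> f a\<close>.\<close>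

lemma sum_card_incidence:
  assumes "finite A" "finite B"
  shows "(\<Sum>b\<in>B. card {a \<in> A. b \<in> f a}) = (\<Sum>a\<in>A. card (f a \<inter> B))"
proof -
  have "(\<Sum>b\<in>B. card {a \<in> A. b \<in> f a}) = (\<Sum>b\<in>B. \<Sum>a\<in>A. if b \<in> f a then 1 else 0)"
    using assms by (simp add: sum.If_cases Int_def)
  also have "\<dots> = (\<Sum>a\<in>A. \<Sum>b\<in>B. if b \<in> f a then 1 else 0)"
    by (rule sum.swap)
  also have "\<dots> = (\<Sum>a\<in>A. card (f a \<inter> B))"
    using assms by (simp add: sum.If_cases Int_def conj_commute)
  finally show ?thesis .
qed

text \<open>Pairs of a permutation and a double ascent on level \<open>Suc k\<close> match pairs
  with a double descent on level \<open>k\<close>. The subtraction can truncate only if level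
  \<open>k\<close> is empty, and then the other factor is zero.\<close>

lemma level_recurrence:
  "Suc k * card (level n \<mu> i (Suc k)) = (n - count \<mu> 1 - 2 * i - k) * card (level n \<mu> i k)"
proof -
  have sub: "dasc n \<pi> \<inter> {1..n} = dasc n \<pi>" "ddes n \<pi> \<inter> {1..n} = ddes n \<pi>" for \<pi>
    by (auto simp: dasc_def ddes_def)
  have "Suc k * card (level n \<mu> i (Suc k)) = (\<Sum>\<pi>\<in>level n \<mu> i (Suc k). card (dasc n \<pi>))"
    by (simp add: level_def)
  also have "\<dots> = (\<Sum>x\<in>{1..n}. card {\<pi> \<in> level n \<mu> i (Suc k). x \<in> dasc n \<pi>})"
    by (subst sum_card_incidence) (simp_all only: sub finite_level finite_atLeastAtMost)
  also have "\<dots> = (\<Sum>x\<in>{1..n}. card {\<pi> \<in> level n \<mu> i k. x \<in> ddes n \<pi>})"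
    by (intro sum.cong card_level_dasc_eq_ddes) auto
  also have "\<dots> = (\<Sum>\<pi>\<in>level n \<mu> i k. card (ddes n \<pi>))"
    by (subst sum_card_incidence) (simp_all only: sub finite_level finite_atLeastAtMost)
  also have "\<dots> = (\<Sum>\<pi>\<in>level n \<mu> i k. n - count \<mu> 1 - 2 * i - k)"
    by (rule sum.cong) (use level_card_sum in fastforce)+
  finally show ?thesis by simp
qed

text \<open>The recurrence is the one satisfied by binomial coefficients in the lower index.\<close>

lemma card_level:
  "card (level n \<mu> i k) = (n - count \<mu> 1 - 2 * i choose k) * card (level n \<mu> i 0)"
proof (induction k)
  case (Suc k)
  define M where "M = n - count \<mu> 1 - 2 * i"
  have "Suc k * card (level n \<mu> i (Suc k)) = (M - k) * (M choose k) * card (level n \<mu> i 0)"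
    using level_recurrence [of k n \<mu> i] Suc by (simp add: M_def)
  \<comment> \<open>Both sides equal \<open>M * (M - 1 choose k)\<close>.\<close>
  also have "(M - k) * (M choose k) = Suc k * (M choose Suc k)"
    by (cases M)
      (simp_all add: binomial_absorb_comp Suc_times_binomial del: binomial_Suc_Suc mult_Suc)
  finally have "Suc k * card (level n \<mu> i (Suc k)) = Suc k * ((M choose Suc k) * card (level n \<mu> i 0))"
    by (simp only: mult.assoc)
  then show ?case
    by (simp only: mult_cancel1 M_def) simp
qed simp

section \<open>The gamma expansion\<close>

lemma one_plus_X_power:
  "[:1, 1 :: 'a :: comm_semiring_1:] ^ M = (\<Sum>k\<le>M. monom (of_nat (M choose k)) k)"
proof -
  have "[:1, 1 :: 'a:] = monom 1 1 + 1"
    by (simp add: monom_altdef one_pCons)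
  then show ?thesis
    by (simp add: binomial_ring monom_power of_nat_monom mult_monom)
qed

theorem corollary8:
  fixes n i :: nat and \<mu> :: "nat multiset"
  assumes "n > 0" and "partition_of n \<mu>"
  shows "gamma_positive (coeff (cval_exc_poly n \<mu>) i)"
proof -
  define L where "L = {\<pi> \<in> perms_of_type n \<mu>. cval n \<pi> = i}"
  \<comment> \<open>The number of points that are not fixed, and twice the center of symmetry;
    \<open>m - 2 * i\<close> is the \<open>M\<close> of the overview.\<close>
  define m where "m = n - count \<mu> 1"
  define N where "N = card (level n \<mu> i 0)"
  have finL: "finite L"
    by (simp add: L_def finite_perms_of_type)
  have poly: "coeff (cval_exc_poly n \<mu>) i = (\<Sum>\<pi>\<in>L. monom 1 (exc n \<pi>))"
    by (simp add: cval_exc_poly_def coeff_sum L_def sum.If_cases finite_perms_of_type Int_def)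
  have bound: "2 * i + card (dasc n \<pi>) \<le> m" if "\<pi> \<in> L" for \<pi>
    using level_card_sum [of \<pi> n \<mu> i "card (dasc n \<pi>)"] that by (simp add: level_def L_def m_def)
  show ?thesis
  \<comment> \<open>If \<open>L\<close> is empty, \<open>i\<close> may exceed
    \<open>m div 2\<close>, and no summand with \<open>j = i\<close> is available; the polynomial is
    then zero.\<close>
  proof (cases "L = {}")
    case True
    then show ?thesis
      unfolding poly gamma_positive_def by (intro exI [of _ 0] exI [of _ "\<lambda>_. 0"]) simp
  next
    case False
    then have i: "i \<le> m div 2" using bound by fastforce
    have "(\<Sum>\<pi>\<in>L. monom (1::int) (exc n \<pi>)) = (\<Sum>\<pi>\<in>L. monom 1 (i + card (dasc n \<pi>)))"
      by (rule sum.cong) (auto simp: L_def perms_of_type_def exc_eq)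
    \<comment> \<open>Grouping by the number of double ascents; \<open>bound\<close> shows that the
      range of \<open>k\<close> catches every permutation in \<open>L\<close>.\<close>
    also have "\<dots> = (\<Sum>k\<le>m - 2 * i. \<Sum>\<pi>\<in>{\<pi> \<in> L. card (dasc n \<pi>) = k}. monom 1 (i + card (dasc n \<pi>)))"
      by (rule sum.group [symmetric]) (use finL bound in fastforce)+
    also have "\<dots> = (\<Sum>k\<le>m - 2 * i. of_nat (card (level n \<mu> i k)) * monom 1 (i + k))"
    proof (rule sum.cong [OF refl])
      fix k
      have "{\<pi> \<in> L. card (dasc n \<pi>) = k} = level n \<mu> i k"
        by (auto simp: L_def level_def)
      then show "(\<Sum>\<pi>\<in>{\<pi> \<in> L. card (dasc n \<pi>) = k}. monom 1 (i + card (dasc n \<pi>)))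
          = of_nat (card (level n \<mu> i k)) * monom (1::int) (i + k)"
        by (simp add: level_def)
    qed
    also have "\<dots> = (\<Sum>k\<le>m - 2 * i. of_nat N * monom 1 i * monom (of_nat (m - 2 * i choose k)) k)"
    proof (rule sum.cong [OF refl])
      fix k
      have "of_nat (card (level n \<mu> i k)) * monom (1::int) (i + k)
          = of_nat N * (of_nat (m - 2 * i choose k) * monom 1 (i + k))"
        by (simp add: card_level [of n \<mu> i k] m_def N_def)
      also have "of_nat (m - 2 * i choose k) * monom (1::int) (i + k)
          = monom 1 i * monom (of_nat (m - 2 * i choose k)) k"
        by (simp add: of_nat_monom mult_monom)
      finally show "of_nat (card (level n \<mu> i k)) * monom (1::int) (i + k)
          = of_nat N * monom 1 i * monom (of_nat (m - 2 * i choose k)) k"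
        by (simp only: mult.assoc)
    qed
    also have "\<dots> = of_nat N * [:0, 1:] ^ i * [:1, 1:] ^ (m - 2 * i)"
    proof -
      have "[:0, 1 :: int:] ^ i = monom 1 i" by (simp add: monom_altdef)
      then show ?thesis by (simp only: one_plus_X_power sum_distrib_left)
    qed
    \<comment> \<open>A single gamma coefficient is possibly nonzero: the one at
      \<open>j = i\<close>, which counts the permutations in \<open>L\<close> without double
      ascents.\<close>
    also have "\<dots> = (\<Sum>j\<le>m div 2. of_nat (if j = i then N else 0) * [:0, 1:] ^ j * [:1, 1:] ^ (m - 2 * j))"
    proof -
      have "(\<Sum>j\<le>m div 2. of_nat (if j = i then N else 0) * [:0, 1:] ^ j * [:1, 1:] ^ (m - 2 * j))
          = (\<Sum>j\<le>m div 2. if j = i then of_nat N * [:0, 1::int:] ^ j * [:1, 1:] ^ (m - 2 * j) else 0)"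
        by (rule sum.cong [OF refl]) (simp split: if_split)
      also have "\<dots> = of_nat N * [:0, 1:] ^ i * [:1, 1:] ^ (m - 2 * i)"
        using i by (simp only: sum.delta finite_atMost atMost_iff if_True)
      finally show ?thesis by (rule sym)
    qed
    finally show ?thesis
      unfolding poly gamma_positive_def
      by (intro exI [of _ m] exI [of _ "\<lambda>j. if j = i then N else 0"])
  qed
qed

end
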